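(* Let $R$ be a $G$-graded ring and let $M$ be a $G$-graded weakly topological $R$-module which is $G$-graded pseudo weakly primeful. If $\Upsilon_M$ is connected (in the Zariski topology), then $\Upsilon_{R^\star}$ is connected, where $R^\star=R/Ann(M)$.
   Context: Conventions: $G$ is an abelian group with identity $e$; rings are commutative with identity and modules are unital. A ring $R$ is $G$-graded if $R=\bigoplus_{g\in G}R_g$ with additive subgroups $R_g$ and $R_gR_h\subseteq R_{gh}$; $h(R)=\bigcup_{g}R_g$. An ideal $I$ of $R$ is graded if $I=\bigoplus_g (I\cap R_g)$. An $R$-module $M$ is $G$-graded if $M=\bigoplus_{g}M_g$ with additive subgroups $M_g$ and $R_gM_h\subseteq M_{gh}$. A submodule $P$ of $M$ is graded if $P=\bigoplus_g (P\cap M_g)$. Put $(P:_RM)=\{r\in R: rM\subseteq P\}$ and $Ann(M)=(0:_RM)$. A proper graded ideal $I$ of $R$ is graded weakly prime if whenever $a,b\in h(R)$ and $0\neq ab\in I$, then $a\in I$ or $b\in I$. $GWSpec(R)$ is the set of graded weakly prime ideals of $R$. A graded submodule $P$ of $M$ is graded pseudo weakly prime if $(P:_RM)$ is a graded weakly prime ideal of $R$; $\Upsilon_M$ is the set of all graded pseudo weakly prime submodules of $M$. A graded submodule of $M$ is graded pseudo weakly semiprime if it is an intersection of graded pseudo weakly prime submodules of $M$. A graded pseudo weakly prime submodule $P$ of $M$ is graded weakly extraordinary if whenever $I,J$ are graded pseudo weakly semiprime submodules of $M$ with $\{0\}\neq I\cap J\subseteq P$, then $I\subseteq P$ or $J\subseteq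 P$. $M$ is $G$-graded weakly topological if $\Upsilon_M=\emptyset$ or every graded pseudo weakly prime submodule of $M$ is graded weakly extraordinary. For a graded submodule $P$ of $M$, $\chi(P)=\{I\in\Upsilon_M: P\subseteq I\}$. The Zariski topology on $\Upsilon_M$ is the topology whose closed sets are exactly the sets $\chi(P)$, $P$ a graded submodule of $M$. For a $G$-graded ring $S$, $\Upsilon_S$ is obtained by viewing $S$ as a graded module over itself, so $\Upsilon_S=GWSpec(S)$ with closed sets $\chi^S(J)=\{I\in GWSpec(S): J\subseteq I\}$, $J$ a graded ideal of $S$. The natural map is $\varphi:\Upsilon_M\to GWSpec(R/Ann(M))$, $\varphi(P)=(P:_RM)/Ann(M)$. $M$ is $G$-graded pseudo weakly primeful if either $M=\{0\}$, or $M\neq\{0\}$ and $\varphi$ is surjective.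
   Formalization: The sets χ(P) need not be closed under finite unions (e.g. Z/6 over itself, trivially graded), so the Zariski topology is taken as the coarsest one in which all χ(P) are closed; it is the stated topology whenever that one exists. *)

theory Defs
  imports "HOL-Algebra.QuotRing" "HOL-Algebra.Module" "HOL-Analysis.Abstract_Topology"
begin

section \<open>Gradings\<close>

text \<open>
  A grading is a family of subsets indexed by the carrier of the group; its values at indices
  outside the carrier are irrelevant.  The additive structure is passed as a ring record, because
  in HOL-Algebra module records extend ring records: the same definition serves rings, modules,
  ideals and submodules.

  Internal direct sum: every element of \<open>S\<close> is the sum of exactly one finitely supported
  family, and every such sum lies in \<open>S\<close>.
\<close>

definition finsupp_families ::
    "('a, 'm) ring_scheme \<Rightarrow> 'i set \<Rightarrow> ('i \<Rightarrow> 'a set) \<Rightarrow> ('i \<Rightarrow> 'a) set" where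
  "finsupp_families X I A = {f \<in> (\<Pi>\<^sub>E i\<in>I. A i). finite {i \<in> I. f i \<noteq> \<zero>\<^bsub>X\<^esub>}}"

definition internal_direct_sum ::
    "('a, 'm) ring_scheme \<Rightarrow> 'i set \<Rightarrow> ('i \<Rightarrow> 'a set) \<Rightarrow> 'a set \<Rightarrow> bool" where
  "internal_direct_sum X I A S \<longleftrightarrow>
     (\<forall>i\<in>I. additive_subgroup (A i) X) \<and>
     bij_betw (\<lambda>f. finsum X f {i \<in> I. f i \<noteq> \<zero>\<^bsub>X\<^esub>}) (finsupp_families X I A) S"

definition graded_ring ::
    "('g, 'k) monoid_scheme \<Rightarrow> ('a, 'm) ring_scheme \<Rightarrow> ('g \<Rightarrow> 'a set) \<Rightarrow> bool" where
  "graded_ring G R A \<longleftrightarrow>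
     cring R \<and> internal_direct_sum R (carrier G) A (carrier R) \<and>
     (\<forall>g\<in>carrier G. \<forall>h\<in>carrier G. \<forall>a\<in>A g. \<forall>b\<in>A h. a \<otimes>\<^bsub>R\<^esub> b \<in> A (g \<otimes>\<^bsub>G\<^esub> h))"

definition homogeneous :: "('g, 'k) monoid_scheme \<Rightarrow> ('g \<Rightarrow> 'a set) \<Rightarrow> 'a set" where
  "homogeneous G A = (\<Union>g\<in>carrier G. A g)"

definition graded_ideal ::
    "('g, 'k) monoid_scheme \<Rightarrow> ('a, 'm) ring_scheme \<Rightarrow> ('g \<Rightarrow> 'a set) \<Rightarrow> 'a set \<Rightarrow> bool" where
  "graded_ideal G R A I \<longleftrightarrow>
     ideal I R \<and> internal_direct_sum R (carrier G) (\<lambda>g. I \<inter> A g) I"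

definition graded_module ::
    "('g, 'k) monoid_scheme \<Rightarrow> ('a, 'm) ring_scheme \<Rightarrow> ('g \<Rightarrow> 'a set) \<Rightarrow>
     ('a, 'b, 'n) module_scheme \<Rightarrow> ('g \<Rightarrow> 'b set) \<Rightarrow> bool" where
  "graded_module G R A M B \<longleftrightarrow>
     Module.module R M \<and> internal_direct_sum M (carrier G) B (carrier M) \<and>
     (\<forall>g\<in>carrier G. \<forall>h\<in>carrier G. \<forall>a\<in>A g. \<forall>x\<in>B h. a \<odot>\<^bsub>M\<^esub> x \<in> B (g \<otimes>\<^bsub>G\<^esub> h))"

definition graded_submodule ::
    "('g, 'k) monoid_scheme \<Rightarrow> ('a, 'm) ring_scheme \<Rightarrow>
     ('a, 'b, 'n) module_scheme \<Rightarrow> ('g \<Rightarrow> 'b set) \<Rightarrow> 'b set \<Rightarrow> bool" where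
  "graded_submodule G R M B P \<longleftrightarrow>
     submodule P R M \<and> internal_direct_sum M (carrier G) (\<lambda>g. P \<inter> B g) P"


section \<open>Graded weakly prime ideals and graded pseudo weakly prime submodules\<close>

definition graded_weakly_prime ::
    "('g, 'k) monoid_scheme \<Rightarrow> ('a, 'm) ring_scheme \<Rightarrow> ('g \<Rightarrow> 'a set) \<Rightarrow> 'a set \<Rightarrow> bool" where
  "graded_weakly_prime G R A I \<longleftrightarrow>
     graded_ideal G R A I \<and> I \<noteq> carrier R \<and>
     (\<forall>a\<in>homogeneous G A. \<forall>b\<in>homogeneous G A.
        a \<otimes>\<^bsub>R\<^esub> b \<noteq> \<zero>\<^bsub>R\<^esub> \<and> a \<otimes>\<^bsub>R\<^esub> b \<in> I \<longrightarrow> a \<in> I \<or> b \<in> I)"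

definition GWSpec ::
    "('g, 'k) monoid_scheme \<Rightarrow> ('a, 'm) ring_scheme \<Rightarrow> ('g \<Rightarrow> 'a set) \<Rightarrow> 'a set set" where
  "GWSpec G R A = {I. graded_weakly_prime G R A I}"

definition residual ::
    "('a, 'm) ring_scheme \<Rightarrow> ('a, 'b, 'n) module_scheme \<Rightarrow> 'b set \<Rightarrow> 'a set" where
  "residual R M P = {r \<in> carrier R. \<forall>x\<in>carrier M. r \<odot>\<^bsub>M\<^esub> x \<in> P}"

definition Ann :: "('a, 'm) ring_scheme \<Rightarrow> ('a, 'b, 'n) module_scheme \<Rightarrow> 'a set" where
  "Ann R M = residual R M {\<zero>\<^bsub>M\<^esub>}"

definition Upsilon ::
    "('g, 'k) monoid_scheme \<Rightarrow> ('a, 'm) ring_scheme \<Rightarrow> ('g \<Rightarrow> 'a set) \<Rightarrow>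
     ('a, 'b, 'n) module_scheme \<Rightarrow> ('g \<Rightarrow> 'b set) \<Rightarrow> 'b set set" where
  "Upsilon G R A M B =
     {P. graded_submodule G R M B P \<and> graded_weakly_prime G R A (residual R M P)}"

text \<open>
  Intersections are taken over nonempty families.  Admitting the empty family would only add
  \<open>carrier M\<close>, which does not affect \<open>graded_weakly_extraordinary\<close>.
\<close>

definition graded_pseudo_weakly_semiprime ::
    "('g, 'k) monoid_scheme \<Rightarrow> ('a, 'm) ring_scheme \<Rightarrow> ('g \<Rightarrow> 'a set) \<Rightarrow>
     ('a, 'b, 'n) module_scheme \<Rightarrow> ('g \<Rightarrow> 'b set) \<Rightarrow> 'b set \<Rightarrow> bool" where
  "graded_pseudo_weakly_semiprime G R A M B N \<longleftrightarrow>
     graded_submodule G R M B N \<and>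
     (\<exists>F. F \<noteq> {} \<and> F \<subseteq> Upsilon G R A M B \<and> N = \<Inter>F)"

definition graded_weakly_extraordinary ::
    "('g, 'k) monoid_scheme \<Rightarrow> ('a, 'm) ring_scheme \<Rightarrow> ('g \<Rightarrow> 'a set) \<Rightarrow>
     ('a, 'b, 'n) module_scheme \<Rightarrow> ('g \<Rightarrow> 'b set) \<Rightarrow> 'b set \<Rightarrow> bool" where
  "graded_weakly_extraordinary G R A M B P \<longleftrightarrow>
     P \<in> Upsilon G R A M B \<and>
     (\<forall>I J. graded_pseudo_weakly_semiprime G R A M B I \<and>
            graded_pseudo_weakly_semiprime G R A M B J \<and>
            {\<zero>\<^bsub>M\<^esub>} \<noteq> I \<inter> J \<and> I \<inter> J \<subseteq> P \<longrightarrow> I \<subseteq> P \<or> J \<subseteq> P)"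

definition graded_weakly_topological ::
    "('g, 'k) monoid_scheme \<Rightarrow> ('a, 'm) ring_scheme \<Rightarrow> ('g \<Rightarrow> 'a set) \<Rightarrow>
     ('a, 'b, 'n) module_scheme \<Rightarrow> ('g \<Rightarrow> 'b set) \<Rightarrow> bool" where
  "graded_weakly_topological G R A M B \<longleftrightarrow>
     Upsilon G R A M B = {} \<or>
     (\<forall>P\<in>Upsilon G R A M B. graded_weakly_extraordinary G R A M B P)"


section \<open>The Zariski topology\<close>

definition chi ::
    "('g, 'k) monoid_scheme \<Rightarrow> ('a, 'm) ring_scheme \<Rightarrow> ('g \<Rightarrow> 'a set) \<Rightarrow>
     ('a, 'b, 'n) module_scheme \<Rightarrow> ('g \<Rightarrow> 'b set) \<Rightarrow> 'b set \<Rightarrow> 'b set set" where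
  "chi G R A M B P = {I \<in> Upsilon G R A M B. P \<subseteq> I}"

text \<open>
  The sets \<open>\<chi>(P)\<close> need not be closed under finite unions, even if \<open>M\<close> is graded
  weakly topological: for the ring of integers modulo 6, trivially graded and viewed as a module
  over itself, the union of \<open>\<chi>((2)) = {(2)}\<close> and \<open>\<chi>((3)) = {(3)}\<close> is not
  of the form \<open>\<chi>(P)\<close>, because \<open>(0)\<close> is weakly prime.  The topology is therefore
  defined as the coarsest one in which all \<open>\<chi>(P)\<close> are closed; by
  \<open>zariski_topology_unique\<close> below it is the topology whose closed sets are exactly the
  \<open>\<chi>(P)\<close> whenever such a topology exists.
\<close>

definition zariski_topology ::
    "('g, 'k) monoid_scheme \<Rightarrow> ('a, 'm) ring_scheme \<Rightarrow> ('g \<Rightarrow> 'a set) \<Rightarrow>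
     ('a, 'b, 'n) module_scheme \<Rightarrow> ('g \<Rightarrow> 'b set) \<Rightarrow> 'b set topology" where
  "zariski_topology G R A M B =
     topology_generated_by
       {Upsilon G R A M B - chi G R A M B P | P. graded_submodule G R M B P}"

lemma zariski_topology_unique:
  assumes "topspace T = Upsilon G R A M B"
    and "\<And>C. closedin T C \<longleftrightarrow> (\<exists>P. graded_submodule G R M B P \<and> C = chi G R A M B P)"
  shows "zariski_topology G R A M B = T"
proof -
  let ?\<S> = "{Upsilon G R A M B - chi G R A M B P | P. graded_submodule G R M B P}"
  have sub: "chi G R A M B P \<subseteq> Upsilon G R A M B" for P
    by (auto simp: chi_def)
  have op: "openin T U \<longleftrightarrow> U \<in> ?\<S>" for U
  proof
    assume U: "openin T U"
    then obtain P where P: "graded_submodule G R M B P" "topspace T - U = chi G R A M B P"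
      using assms(2) closedin_diff[OF closedin_topspace U] by blast
    moreover have "U = Upsilon G R A M B - chi G R A M B P"
      using P(2) openin_subset[OF U] assms(1) by blast
    ultimately show "U \<in> ?\<S>"
      by blast
  next
    assume "U \<in> ?\<S>"
    then show "openin T U"
      using assms sub openin_diff[OF openin_topspace, of T] by fastforce
  qed
  have "openin T U" if "generate_topology_on ?\<S> U" for U
    using that
  proof (induction rule: generate_topology_on.induct)
    case (Basis s)
    then show ?case using op by blast
  qed auto
  then show ?thesis
    unfolding zariski_topology_def topology_eq openin_topology_generated_by_iff
    using op by (meson generate_topology_on.Basis)
qed


section \<open>A ring as a module over itself\<close>

definition ring_as_module :: "('a, 'm) ring_scheme \<Rightarrow> ('a, 'a) module" where
  "ring_as_module S =
     \<lparr>carrier = carrier S, monoid.mult = monoid.mult S, one = \<one>\<^bsub>S\<^esub>,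
      zero = \<zero>\<^bsub>S\<^esub>, add = add S, smult = monoid.mult S\<rparr>"

lemma ring_as_module_simps [simp]:
  "carrier (ring_as_module S) = carrier S"
  "\<zero>\<^bsub>ring_as_module S\<^esub> = \<zero>\<^bsub>S\<^esub>"
  "add (ring_as_module S) = add S"
  "smult (ring_as_module S) = monoid.mult S"
  by (simp_all add: ring_as_module_def)

lemma subgroup_ring_as_module:
  "subgroup H (add_monoid (ring_as_module S)) \<longleftrightarrow> subgroup H (add_monoid S)"
  by (simp add: subgroup_def m_inv_def)

lemma internal_direct_sum_ring_as_module:
  fixes S :: "('a, 'm) ring_scheme" and I :: "'i set"
  shows "internal_direct_sum (ring_as_module S) I A T = internal_direct_sum S I A T"
proof -
  have "finsum (ring_as_module S) f F = finsum S f F" for f :: "'i \<Rightarrow> 'a" and F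
    by (simp add: finsum_def finprod_def)
  then show ?thesis
    unfolding internal_direct_sum_def finsupp_families_def additive_subgroup_def
      subgroup_ring_as_module
    by simp
qed

lemma submodule_ring_as_module:
  assumes "cring S"
  shows "submodule I S (ring_as_module S) \<longleftrightarrow> ideal I S"
proof -
  interpret cring S by fact
  show ?thesis
  proof
    assume "submodule I S (ring_as_module S)"
    then have sub: "subgroup I (add_monoid S)"
      and mul: "\<And>a x. a \<in> carrier S \<Longrightarrow> x \<in> I \<Longrightarrow> a \<otimes>\<^bsub>S\<^esub> x \<in> I"
      unfolding submodule_def submodule_axioms_def subgroup_ring_as_module by auto
    have "I \<subseteq> carrier S"
      using subgroup.subset[OF sub] by simp
    then have mul': "x \<otimes>\<^bsub>S\<^esub> a \<in> I" if "a \<in> carrier S" "x \<in> I" for a x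
      using mul[OF that] m_comm[of x a] that by auto
    show "ideal I S"
      by (rule idealI[OF ring_axioms sub]) (use mul mul' in blast)+
  next
    assume "ideal I S"
    then interpret ideal I S .
    show "submodule I S (ring_as_module S)"
      unfolding submodule_def submodule_axioms_def subgroup_ring_as_module
      using a_subgroup I_l_closed by auto
  qed
qed

lemma graded_submodule_ring_as_module:
  assumes "cring S"
  shows "graded_submodule G S (ring_as_module S) A I \<longleftrightarrow> graded_ideal G S A I"
  by (simp add: graded_submodule_def graded_ideal_def submodule_ring_as_module[OF assms]
      internal_direct_sum_ring_as_module)

lemma residual_ring_as_module:
  assumes "cring S" "ideal I S"
  shows "residual S (ring_as_module S) I = I"
proof -
  interpret cring S by fact
  interpret ideal I S by fact
  have "r \<in> I" if "r \<in> carrier S" "\<forall>x\<in>carrier S. r \<otimes>\<^bsub>S\<^esub> x \<in> I" for r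
    using that(2)[rule_format, OF one_closed] that(1) by simp
  moreover have "r \<in> carrier S" "\<forall>x\<in>carrier S. r \<otimes>\<^bsub>S\<^esub> x \<in> I" if "r \<in> I" for r
    using that I_r_closed Icarr by blast+
  ultimately show ?thesis
    unfolding residual_def ring_as_module_simps by blast
qed

lemma Upsilon_ring_as_module:
  assumes "cring S"
  shows "Upsilon G S A (ring_as_module S) A = GWSpec G S A"
proof -
  have gwp: "graded_ideal G S A I" if "graded_weakly_prime G S A I" for I
    using that by (simp add: graded_weakly_prime_def)
  have res: "residual S (ring_as_module S) I = I" if "graded_ideal G S A I" for I
    using that residual_ring_as_module[OF assms] by (simp add: graded_ideal_def)
  show ?thesis
    unfolding Upsilon_def GWSpec_def graded_submodule_ring_as_module[OF assms]
  proof (intro Collect_cong iffI)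
    fix I assume "graded_ideal G S A I \<and> graded_weakly_prime G S A (residual S (ring_as_module S) I)"
    then show "graded_weakly_prime G S A I"
      using res[of I] by simp
  next
    fix I assume "graded_weakly_prime G S A I"
    then show "graded_ideal G S A I \<and> graded_weakly_prime G S A (residual S (ring_as_module S) I)"
      using gwp[of I] res[of I] by simp
  qed
qed


section \<open>The natural map\<close>

definition quotient_grading ::
    "('a, 'm) ring_scheme \<Rightarrow> ('g \<Rightarrow> 'a set) \<Rightarrow> 'a set \<Rightarrow> 'g \<Rightarrow> 'a set set" where
  "quotient_grading R A I g = (\<lambda>r. I +>\<^bsub>R\<^esub> r) ` A g"

definition natural_map ::
    "('a, 'm) ring_scheme \<Rightarrow> ('a, 'b, 'n) module_scheme \<Rightarrow> 'b set \<Rightarrow> 'a set set" where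
  "natural_map R M P = (\<lambda>r. Ann R M +>\<^bsub>R\<^esub> r) ` residual R M P"

definition graded_pseudo_weakly_primeful ::
    "('g, 'k) monoid_scheme \<Rightarrow> ('a, 'm) ring_scheme \<Rightarrow> ('g \<Rightarrow> 'a set) \<Rightarrow>
     ('a, 'b, 'n) module_scheme \<Rightarrow> ('g \<Rightarrow> 'b set) \<Rightarrow> bool" where
  "graded_pseudo_weakly_primeful G R A M B \<longleftrightarrow>
     carrier M = {\<zero>\<^bsub>M\<^esub>} \<or>
     carrier M \<noteq> {\<zero>\<^bsub>M\<^esub>} \<and>
     natural_map R M ` Upsilon G R A M B =
       GWSpec G (R Quot Ann R M) (quotient_grading R A (Ann R M))"

end

theory Submission
  imports Defs
begin

text \<open>
  If \<open>M\<close> is nonzero, primefulness says that the natural map sends \<open>\<Upsilon>\<^sub>M\<close> onto the spectrum of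
  \<open>R/Ann(M)\<close>, so it suffices that the natural map is continuous: a continuous image of a
  connected space is connected.  If \<open>M\<close> is zero, then \<open>R/Ann(M)\<close> is the zero ring, which has no
  proper ideal, and the target space is empty.

  Continuity is checked on the subbasis (\<open>preimage_chi_natural_map\<close>).  For any set \<open>J\<close> of cosets
  let \<open>C\<close> be the set of all \<open>P \<in> \<Upsilon>\<^sub>M\<close> with \<open>J \<subseteq> \<phi>(P)\<close>.  If \<open>C\<close> is empty, it is closed.
  Otherwise \<open>\<phi>(\<Inter>C)\<close> still contains \<open>J\<close>, because membership in \<open>(P : M)\<close> depends only on the coset
  modulo \<open>Ann(M)\<close>; since \<open>\<phi>\<close> is monotone, \<open>C = \<chi>(\<Inter>C)\<close>, and \<open>\<Inter>C\<close> is graded as an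
  intersection of graded submodules (\<open>graded_submodule_Inter\<close>).

  The topologies being given by subbases, the underlying set of each space is the union of the
  subbasic open sets.  It is all of \<open>\<Upsilon>\<close> because the whole module is itself a graded submodule
  contained in no member of \<open>\<Upsilon>\<close>.  For \<open>R/Ann(M)\<close> this requires the images of the homogeneous
  components of \<open>R\<close> to form a grading (\<open>graded_ring_quotient_Ann\<close>), that is, \<open>Ann(M)\<close> to be a
  graded ideal.
\<close>

section \<open>Internal direct sums\<close>

lemma finsum_in_additive_subgroup:
  assumes "abelian_group X" "additive_subgroup S X" "f \<in> F \<rightarrow> S"
  shows "finsum X f F \<in> S"
proof -
  interpret abelian_group X by fact
  interpret S: additive_subgroup S X by fact
  show ?thesis
    using assms(3)
  proof (induction F rule: infinite_finite_induct)
    case (insert i F)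
    then have "f \<in> F \<rightarrow> carrier X" "f i \<in> carrier X"
      using S.a_subset by auto
    with insert show ?case
      by (simp add: finsum_insert)
  qed simp_all
qed

text \<open>The sum over the support may be taken over any finite index set containing the support.\<close>

lemma finsum_support:
  assumes "abelian_group X" "finite F" "F \<subseteq> I" "f \<in> F \<rightarrow> carrier X"
    and "\<And>i. i \<in> I - F \<Longrightarrow> f i = \<zero>\<^bsub>X\<^esub>"
  shows "finsum X f {i \<in> I. f i \<noteq> \<zero>\<^bsub>X\<^esub>} = finsum X f F"
proof -
  interpret abelian_group X by fact
  show ?thesis
    by (rule add.finprod_mono_neutral_cong_left) (use assms in auto)
qed

lemma internal_direct_sum_decompose:
  assumes "internal_direct_sum X I A S" "x \<in> S"
  obtains f where "f \<in> finsupp_families X I A" "x = finsum X f {i \<in> I. f i \<noteq> \<zero>\<^bsub>X\<^esub>}"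
proof -
  have "x \<in> (\<lambda>f. finsum X f {i \<in> I. f i \<noteq> \<zero>\<^bsub>X\<^esub>}) ` finsupp_families X I A"
    using assms by (simp add: internal_direct_sum_def bij_betw_def)
  then show thesis
    using that by (rule imageE)
qed

text \<open>
  In a direct sum, homogeneous components that sum to zero vanish; conversely, by
  \<open>internal_direct_sumI\<close>, this independence gives the uniqueness of decompositions.
\<close>

lemma internal_direct_sum_independent:
  assumes "abelian_group X" "internal_direct_sum X I A S"
    and "finite F" "F \<subseteq> I" "\<And>i. i \<in> F \<Longrightarrow> f i \<in> A i"
    and "finsum X f F = \<zero>\<^bsub>X\<^esub>" "i \<in> F"
  shows "f i = \<zero>\<^bsub>X\<^esub>"
proof -
  interpret abelian_group X by fact
  have sub: "additive_subgroup (A i) X" if "i \<in> I" for i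
    using assms(2) that unfolding internal_direct_sum_def by blast
  have zeroA: "\<zero>\<^bsub>X\<^esub> \<in> A i" and Acarr: "A i \<subseteq> carrier X" if "i \<in> I" for i
    using additive_subgroup.zero_closed[OF sub[OF that]]
      additive_subgroup.a_subset[OF sub[OF that]] by auto
  define g where "g = (\<lambda>i\<in>I. if i \<in> F then f i else \<zero>\<^bsub>X\<^esub>)"
  define z where "z = (\<lambda>i\<in>I. \<zero>\<^bsub>X\<^esub>)"
  have "{i \<in> I. g i \<noteq> \<zero>\<^bsub>X\<^esub>} \<subseteq> F"
    by (auto simp: g_def split: if_splits)
  then have g: "g \<in> finsupp_families X I A"
    unfolding finsupp_families_def
    using assms(3-5) zeroA finite_subset by (fastforce simp: g_def)
  have z: "z \<in> finsupp_families X I A"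
    unfolding finsupp_families_def using zeroA by (auto simp: z_def)
  have gcarr: "g \<in> F \<rightarrow> carrier X"
    using assms(4,5) Acarr by (fastforce simp: g_def)
  have "finsum X g {i \<in> I. g i \<noteq> \<zero>\<^bsub>X\<^esub>} = finsum X g F"
    by (rule finsum_support) (use assms gcarr in \<open>auto simp: g_def\<close>)
  also have "\<dots> = finsum X f F"
    by (rule finsum_cong') (use assms(4,5) Acarr in \<open>auto simp: g_def\<close>)
  also have "\<dots> = finsum X z {i \<in> I. z i \<noteq> \<zero>\<^bsub>X\<^esub>}"
    using assms(6) by (simp add: z_def)
  finally have "g = z"
    using g z assms(2) unfolding internal_direct_sum_def bij_betw_def inj_on_def by blast
  then have "g i = z i"
    by simp
  then show ?thesis
    using assms(4,7) by (auto simp: g_def z_def)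
qed

lemma internal_direct_sumI:
  assumes "abelian_group X" "additive_subgroup S X"
    and sub: "\<And>i. i \<in> I \<Longrightarrow> additive_subgroup (A i) X"
    and AS: "\<And>i. i \<in> I \<Longrightarrow> A i \<subseteq> S"
    and gen: "\<And>x. x \<in> S \<Longrightarrow>
      \<exists>f\<in>finsupp_families X I A. x = finsum X f {i \<in> I. f i \<noteq> \<zero>\<^bsub>X\<^esub>}"
    and indep: "\<And>F f i. \<lbrakk>finite F; F \<subseteq> I; \<And>i. i \<in> F \<Longrightarrow> f i \<in> A i;
      finsum X f F = \<zero>\<^bsub>X\<^esub>; i \<in> F\<rbrakk> \<Longrightarrow> f i = \<zero>\<^bsub>X\<^esub>"
  shows "internal_direct_sum X I A S"
proof -
  interpret abelian_group X by fact
  let ?s = "\<lambda>f. finsum X f {i \<in> I. f i \<noteq> \<zero>\<^bsub>X\<^esub>}"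
  let ?D = "finsupp_families X I A"
  have Acarr: "A i \<subseteq> carrier X" if "i \<in> I" for i
    by (rule additive_subgroup.a_subset[OF sub[OF that]])
  have "f = g" if f: "f \<in> ?D" and g: "g \<in> ?D" and eq: "?s f = ?s g" for f g
  proof -
    define F where "F = {i \<in> I. f i \<noteq> \<zero>\<^bsub>X\<^esub>} \<union> {i \<in> I. g i \<noteq> \<zero>\<^bsub>X\<^esub>}"
    have F: "finite F" "F \<subseteq> I"
      using f g by (auto simp: F_def finsupp_families_def)
    have fA: "f i \<in> A i" "g i \<in> A i" if "i \<in> I" for i
      using f g that by (auto simp: finsupp_families_def)
    then have fcarr: "f i \<in> carrier X" "g i \<in> carrier X" if "i \<in> I" for i
      using Acarr that by blast+
    have sF: "?s f = finsum X f F" "?s g = finsum X g F"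
      by (rule finsum_support; use F fcarr in \<open>auto simp: F_def assms(1)\<close>)+
    have "finsum X (\<lambda>i. f i \<oplus>\<^bsub>X\<^esub> (\<ominus>\<^bsub>X\<^esub> g i)) F \<oplus>\<^bsub>X\<^esub> finsum X g F
        = finsum X (\<lambda>i. (f i \<oplus>\<^bsub>X\<^esub> (\<ominus>\<^bsub>X\<^esub> g i)) \<oplus>\<^bsub>X\<^esub> g i) F"
      by (rule finsum_addf[symmetric]) (use F fcarr in auto)
    also have "\<dots> = finsum X f F"
      by (rule finsum_cong') (use F fcarr in \<open>auto simp: a_assoc l_neg subset_iff\<close>)
    also have "\<dots> = finsum X g F"
      using eq sF by simp
    finally have "finsum X (\<lambda>i. f i \<oplus>\<^bsub>X\<^esub> (\<ominus>\<^bsub>X\<^esub> g i)) F \<oplus>\<^bsub>X\<^esub> finsum X g F = finsum X g F" .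
    moreover have "finsum X g F \<in> carrier X"
        "finsum X (\<lambda>i. f i \<oplus>\<^bsub>X\<^esub> (\<ominus>\<^bsub>X\<^esub> g i)) F \<in> carrier X"
      using F fcarr by (auto intro!: finsum_closed)
    ultimately have sum0: "finsum X (\<lambda>i. f i \<oplus>\<^bsub>X\<^esub> (\<ominus>\<^bsub>X\<^esub> g i)) F = \<zero>\<^bsub>X\<^esub>"
      by simp
    have "f i = g i" if "i \<in> I" for i
    proof (cases "i \<in> F")
      case True
      have "f j \<oplus>\<^bsub>X\<^esub> (\<ominus>\<^bsub>X\<^esub> g j) \<in> A j" if "j \<in> F" for j
        using sub[of j] fA[of j] F that
        by (auto intro: additive_subgroup.a_closed additive_subgroup.a_inv_closed[OF sub])
      then have "f i \<oplus>\<^bsub>X\<^esub> (\<ominus>\<^bsub>X\<^esub> g i) = \<zero>\<^bsub>X\<^esub>"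
        using indep[OF F _ sum0 True] by blast
      then show ?thesis
        using fcarr[OF that] by (metis minus_equality minus_minus a_inv_closed)
    qed (use that in \<open>auto simp: F_def\<close>)
    then show ?thesis
      using f g unfolding finsupp_families_def by (blast intro: PiE_ext)
  qed
  then have "inj_on ?s ?D"
    by (rule inj_onI)
  moreover have "?s f \<in> S" if "f \<in> ?D" for f
  proof (rule finsum_in_additive_subgroup[OF assms(1,2)])
    show "f \<in> {i \<in> I. f i \<noteq> \<zero>\<^bsub>X\<^esub>} \<rightarrow> S"
      using that AS by (fastforce simp: finsupp_families_def)
  qed
  then have "?s ` ?D \<subseteq> S"
    by (rule image_subsetI)
  moreover have "S \<subseteq> ?s ` ?D"
    using gen by (simp add: image_iff subset_iff)
  ultimately show ?thesis
    using sub by (simp add: internal_direct_sum_def bij_betw_def subset_antisym)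
qed

lemma internal_direct_sum_Int_carrier:
  assumes "internal_direct_sum X I A (carrier X)"
  shows "internal_direct_sum X I (\<lambda>i. carrier X \<inter> A i) (carrier X)"
proof -
  have A: "carrier X \<inter> A i = A i" if "i \<in> I" for i
    using assms that additive_subgroup.a_subset unfolding internal_direct_sum_def by blast
  have "finsupp_families X I (\<lambda>i. carrier X \<inter> A i) = finsupp_families X I A"
    unfolding finsupp_families_def using A by (simp cong: PiE_cong)
  then show ?thesis
    using assms A unfolding internal_direct_sum_def by simp
qed

section \<open>Intersections of graded submodules\<close>

lemma graded_submodule_carrier:
  assumes "graded_module G R A M B"
  shows "graded_submodule G R M B (carrier M)"
proof -
  have mod: "Module.module R M" and ds: "internal_direct_sum M (carrier G) B (carrier M)"
    using assms unfolding graded_module_def by auto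
  interpret Module.module R M by (rule mod)
  have "internal_direct_sum M (carrier G) (\<lambda>g. carrier M \<inter> B g) (carrier M)"
    by (rule internal_direct_sum_Int_carrier[OF ds])
  then show ?thesis
    unfolding graded_submodule_def using carrier_is_submodule by blast
qed

text \<open>
  Uniqueness of homogeneous decompositions in \<open>M\<close> is what makes the decompositions of an element
  inside the various members of the family agree.
\<close>

lemma graded_submodule_Inter:
  assumes "graded_module G R A M B" "\<F> \<noteq> {}"
    and gr: "\<And>P. P \<in> \<F> \<Longrightarrow> graded_submodule G R M B P"
  shows "graded_submodule G R M B (\<Inter>\<F>)"
proof -
  have mod: "Module.module R M" and ds: "internal_direct_sum M (carrier G) B (carrier M)"
    using assms(1) unfolding graded_module_def by auto
  interpret Module.module R M by (rule mod)
  have ag: "abelian_group M" by (rule M.abelian_group_axioms)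
  have subm: "submodule P R M" if "P \<in> \<F>" for P
    using gr[OF that] by (simp add: graded_submodule_def)
  obtain Q where Q: "Q \<in> \<F>"
    using assms(2) by blast
  have "subgroup (\<Inter>\<F>) (add_monoid M)"
    using subm assms(2) by (intro M.add.subgroups_Inter) (auto simp: submodule_def)
  then have addN: "additive_subgroup (\<Inter>\<F>) M"
    by (rule additive_subgroup.intro)
  have subB: "additive_subgroup (B g) M" if "g \<in> carrier G" for g
    using ds that unfolding internal_direct_sum_def by blast
  have subNB: "additive_subgroup (\<Inter>\<F> \<inter> B g) M" if "g \<in> carrier G" for g
    using addN subB[OF that] by (simp add: additive_subgroup_def M.add.subgroups_Inter_pair)
  have "internal_direct_sum M (carrier G) (\<lambda>g. \<Inter>\<F> \<inter> B g) (\<Inter>\<F>)"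
  proof (rule internal_direct_sumI[OF ag addN subNB])
    fix x assume x: "x \<in> \<Inter>\<F>"
    have dec: "\<exists>f \<in> finsupp_families M (carrier G) (\<lambda>g. P \<inter> B g).
        x = finsum M f {g \<in> carrier G. f g \<noteq> \<zero>\<^bsub>M\<^esub>}" if "P \<in> \<F>" for P
      using gr[OF that] x that internal_direct_sum_decompose[of M "carrier G" "\<lambda>g. P \<inter> B g" P x]
      unfolding graded_submodule_def by blast
    have incl: "finsupp_families M (carrier G) (\<lambda>g. P \<inter> B g) \<subseteq> finsupp_families M (carrier G) B" for P
      unfolding finsupp_families_def by (auto simp: PiE_iff)
    obtain f where f: "f \<in> finsupp_families M (carrier G) (\<lambda>g. Q \<inter> B g)"
        "x = finsum M f {g \<in> carrier G. f g \<noteq> \<zero>\<^bsub>M\<^esub>}"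
      using dec[OF Q] by blast
    have "f \<in> finsupp_families M (carrier G) (\<lambda>g. P \<inter> B g)" if P: "P \<in> \<F>" for P
    proof -
      obtain f' where f': "f' \<in> finsupp_families M (carrier G) (\<lambda>g. P \<inter> B g)"
          "x = finsum M f' {g \<in> carrier G. f' g \<noteq> \<zero>\<^bsub>M\<^esub>}"
        using dec[OF P] by blast
      have "f = f'"
        using ds incl f f' unfolding internal_direct_sum_def bij_betw_def inj_on_def by blast
      with f'(1) show ?thesis by simp
    qed
    then have "f \<in> finsupp_families M (carrier G) (\<lambda>g. \<Inter>\<F> \<inter> B g)"
      using Q unfolding finsupp_families_def by (auto simp: PiE_iff)
    with f(2) show "\<exists>f \<in> finsupp_families M (carrier G) (\<lambda>g. \<Inter>\<F> \<inter> B g).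
        x = finsum M f {g \<in> carrier G. f g \<noteq> \<zero>\<^bsub>M\<^esub>}"
      by blast
  next
    fix F f i
    assume "finite F" "F \<subseteq> carrier G" "\<And>i. i \<in> F \<Longrightarrow> f i \<in> \<Inter>\<F> \<inter> B i"
      "finsum M f F = \<zero>\<^bsub>M\<^esub>" "i \<in> F"
    then show "f i = \<zero>\<^bsub>M\<^esub>"
      using internal_direct_sum_independent[OF ag ds, of F f i] by blast
  qed auto
  moreover have "submodule (\<Inter>\<F>) R M"
    using addN subm by (auto simp: submodule_def submodule_axioms_def additive_subgroup_def)
  ultimately show ?thesis
    by (simp add: graded_submodule_def)
qed

section \<open>The graded ring \<open>R/Ann(M)\<close>\<close>

lemma ideal_residual:
  assumes "Module.module R M" "submodule P R M"
  shows "ideal (residual R M P) R"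
proof -
  interpret Module.module R M by fact
  note P = submoduleE[OF assms(2)]
  have z: "\<zero>\<^bsub>M\<^esub> \<in> P"
    using assms(2) subgroup.one_closed[of P "add_monoid M"] by (simp add: submodule_def)
  show ?thesis
  proof (rule idealI)
    show "subgroup (residual R M P) (add_monoid R)"
    proof (rule subgroup.intro)
      show "\<one>\<^bsub>add_monoid R\<^esub> \<in> residual R M P"
        using z by (simp add: residual_def)
    next
      fix a assume "a \<in> residual R M P"
      then show "inv\<^bsub>add_monoid R\<^esub> a \<in> residual R M P"
        using P(3) by (auto simp: residual_def smult_l_minus a_inv_def[symmetric])
    qed (use P(5) in \<open>auto simp: residual_def smult_l_distr\<close>)
  next
    fix a x assume a: "a \<in> residual R M P" and x: "x \<in> carrier R"
    then have "x \<otimes>\<^bsub>R\<^esub> a \<in> residual R M P"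
      using P(4) by (auto simp: residual_def smult_assoc1)
    then show "x \<otimes>\<^bsub>R\<^esub> a \<in> residual R M P" "a \<otimes>\<^bsub>R\<^esub> x \<in> residual R M P"
      using a x by (auto simp: residual_def R.m_comm)
  qed (rule R.ring_axioms)
qed

lemma ideal_Ann:
  assumes "Module.module R M"
  shows "ideal (Ann R M) R"
proof -
  interpret Module.module R M by fact
  have "submodule {\<zero>\<^bsub>M\<^esub>} R M"
    by (rule submoduleI) auto
  then show ?thesis
    unfolding Ann_def by (rule ideal_residual[OF assms])
qed

text \<open>
  The annihilator is graded: multiplying by a homogeneous element of degree \<open>h\<close> shifts all degrees
  by \<open>h\<close>, so the products of the components of an annihilating sum with such an element lie in
  pairwise different components of \<open>M\<close> and vanish separately.
\<close>

lemma homogeneous_components_in_Ann: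
  assumes "group G" "graded_ring G R A" "graded_module G R A M B"
    and F: "finite F" "F \<subseteq> carrier G"
    and f: "\<And>g. g \<in> F \<Longrightarrow> f g \<in> A g"
    and sum: "finsum R f F \<in> Ann R M" and g: "g \<in> F"
  shows "f g \<in> Ann R M"
proof -
  interpret G: group G by fact
  have mod: "Module.module R M" and ds: "internal_direct_sum M (carrier G) B (carrier M)"
    and AB: "\<And>g h a x. \<lbrakk>g \<in> carrier G; h \<in> carrier G; a \<in> A g; x \<in> B h\<rbrakk>
      \<Longrightarrow> a \<odot>\<^bsub>M\<^esub> x \<in> B (g \<otimes>\<^bsub>G\<^esub> h)"
    using assms(3) unfolding graded_module_def by auto
  interpret Module.module R M by (rule mod)
  have ag: "abelian_group M" by (rule M.abelian_group_axioms)
  have Acarr: "A g \<subseteq> carrier R" if "g \<in> carrier G" for g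
    using assms(2) that additive_subgroup.a_subset
    unfolding graded_ring_def internal_direct_sum_def by blast
  have Bcarr: "B g \<subseteq> carrier M" if "g \<in> carrier G" for g
    using ds that additive_subgroup.a_subset unfolding internal_direct_sum_def by blast
  have fcarr: "f g \<in> carrier R" if "g \<in> F" for g
    using f Acarr F that by blast
  have smult_finsum: "finsum R f K \<odot>\<^bsub>M\<^esub> x = finsum M (\<lambda>k. f k \<odot>\<^bsub>M\<^esub> x) K"
    if "x \<in> carrier M" "K \<subseteq> F" for x K
    using finite_subset[OF that(2) F(1)] that(2)
  proof (induction K rule: finite_induct)
    case (insert k K)
    have "f \<in> K \<rightarrow> carrier R" "f k \<in> carrier R"
      using insert.prems fcarr by auto
    with insert that(1) show ?case
      by (simp add: smult_l_distr Pi_iff)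
  qed (use that(1) in simp)
  have hom: "f g \<odot>\<^bsub>M\<^esub> x = \<zero>\<^bsub>M\<^esub>" if h: "h \<in> carrier G" and x: "x \<in> B h" for h x
  proof -
    have xM: "x \<in> carrier M"
      using Bcarr h x by blast
    \<comment> \<open>The products \<open>f k \<odot> x\<close> are re-indexed by their degrees \<open>k \<otimes> h\<close> in \<open>M\<close>.\<close>
    define t where "t = (\<lambda>k. k \<otimes>\<^bsub>G\<^esub> h)"
    have inj: "inj_on t F"
      using F h by (auto simp: t_def inj_on_def subset_iff)
    define u where "u = (\<lambda>k. f (the_inv_into F t k) \<odot>\<^bsub>M\<^esub> x)"
    have ut: "u (t k) = f k \<odot>\<^bsub>M\<^esub> x" if "k \<in> F" for k
      using inj that by (simp add: u_def the_inv_into_f_f)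
    have "finsum M u (t ` F) = finsum M (\<lambda>k. u (t k)) F"
      by (rule M.finsum_reindex) (use inj ut fcarr xM in auto)
    also have "\<dots> = finsum M (\<lambda>k. f k \<odot>\<^bsub>M\<^esub> x) F"
      by (rule M.finsum_cong') (use ut fcarr xM in auto)
    also have "\<dots> = \<zero>\<^bsub>M\<^esub>"
      using smult_finsum[OF xM, of F] sum xM by (simp add: Ann_def residual_def)
    finally have "finsum M u (t ` F) = \<zero>\<^bsub>M\<^esub>" .
    moreover have "u k \<in> B k" if "k \<in> t ` F" for k
      using that ut f AB h x F by (auto simp: t_def)
    moreover have "t ` F \<subseteq> carrier G"
      using F h by (auto simp: t_def)
    ultimately have "u (t g) = \<zero>\<^bsub>M\<^esub>"
      using internal_direct_sum_independent[OF ag ds, of "t ` F" u "t g"] F g by blast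
    then show ?thesis
      using ut[OF g] by simp
  qed
  have "f g \<odot>\<^bsub>M\<^esub> x = \<zero>\<^bsub>M\<^esub>" if xM: "x \<in> carrier M" for x
  proof -
    obtain c where c: "c \<in> finsupp_families M (carrier G) B"
        "x = finsum M c {h \<in> carrier G. c h \<noteq> \<zero>\<^bsub>M\<^esub>}"
      using internal_direct_sum_decompose[OF ds xM] by blast
    let ?K = "{h \<in> carrier G. c h \<noteq> \<zero>\<^bsub>M\<^esub>}"
    have K: "finite ?K" and cB: "\<And>h. h \<in> ?K \<Longrightarrow> c h \<in> B h"
      using c(1) by (auto simp: finsupp_families_def)
    have "f g \<odot>\<^bsub>M\<^esub> x = finsum M (\<lambda>h. f g \<odot>\<^bsub>M\<^esub> c h) ?K"
      unfolding c(2) by (rule finsum_smult_ldistr) (use K cB Bcarr fcarr g in auto)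
    also have "\<dots> = finsum M (\<lambda>h. \<zero>\<^bsub>M\<^esub>) ?K"
      by (rule M.finsum_cong') (use hom cB in auto)
    finally show ?thesis by simp
  qed
  then show ?thesis
    using fcarr[OF g] by (simp add: Ann_def residual_def)
qed

lemma graded_ring_quotient_Ann:
  assumes "group G" "graded_ring G R A" "graded_module G R A M B"
  shows "graded_ring G (R Quot Ann R M) (quotient_grading R A (Ann R M))"
proof -
  let ?I = "Ann R M" and ?S = "R Quot Ann R M"
  let ?A = "quotient_grading R A ?I"
  let ?p = "\<lambda>r. ?I +>\<^bsub>R\<^esub> r"
  have cr: "cring R" and ds: "internal_direct_sum R (carrier G) A (carrier R)"
    and AA: "\<And>g h a b. \<lbrakk>g \<in> carrier G; h \<in> carrier G; a \<in> A g; b \<in> A h\<rbrakk>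
      \<Longrightarrow> a \<otimes>\<^bsub>R\<^esub> b \<in> A (g \<otimes>\<^bsub>G\<^esub> h)"
    using assms(2) by (simp_all add: graded_ring_def)
  interpret R: cring R by fact
  interpret I: ideal ?I R
    using ideal_Ann[of R M] assms(3) by (simp add: graded_module_def)
  have zS: "\<zero>\<^bsub>?S\<^esub> = ?I"
    by (simp add: FactRing_def)
  have carrS: "carrier ?S = ?p ` carrier R"
    by (auto simp: FactRing_def A_RCOSETS_def RCOSETS_def a_r_coset_def)
  have "?p \<in> hom (add_monoid R) (add_monoid ?S)"
    using I.rcos_ring_hom by (simp add: hom_def ring_hom_def)
  then have gh: "group_hom (add_monoid R) (add_monoid ?S) ?p"
    using abelian_group.a_group[OF R.abelian_group_axioms]
      abelian_group.a_group[OF ring.is_abelian_group[OF I.quotient_is_ring]]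
    by (simp add: group_hom_def group_hom_axioms_def)
  interpret p: ring_hom_cring R ?S ?p
    by (rule I.rcos_ring_hom_cring[OF cr])
  have subA: "additive_subgroup (A g) R" if "g \<in> carrier G" for g
    using ds that unfolding internal_direct_sum_def by blast
  have Acarr: "A g \<subseteq> carrier R" if "g \<in> carrier G" for g
    by (rule additive_subgroup.a_subset[OF subA[OF that]])
  have ker: "r \<in> ?I" if "r \<in> carrier R" "?p r = \<zero>\<^bsub>?S\<^esub>" for r
    using I.a_rcos_self[OF that(1)] that(2) by (simp add: zS)
  have agS: "abelian_group ?S"
    by (rule p.S.abelian_group_axioms)
  have subS: "additive_subgroup (?A g) ?S" if "g \<in> carrier G" for g
  proof -
    show ?thesis
      using group_hom.subgroup_img_is_subgroup[OF gh, of "A g"] subA[OF that]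
      by (simp add: additive_subgroup_def quotient_grading_def)
  qed
  have "internal_direct_sum ?S (carrier G) ?A (carrier ?S)"
  proof (rule internal_direct_sumI[OF agS _ subS])
    show "additive_subgroup (carrier ?S) ?S"
      using p.S.add.subgroup_self by (simp add: additive_subgroup_def)
  next
    fix g assume "g \<in> carrier G"
    then show "?A g \<subseteq> carrier ?S"
      using Acarr unfolding quotient_grading_def carrS by blast
  next
    fix y assume "y \<in> carrier ?S"
    then obtain x where x: "x \<in> carrier R" "y = ?p x"
      unfolding carrS by blast
    obtain c where c: "c \<in> finsupp_families R (carrier G) A"
        "x = finsum R c {h \<in> carrier G. c h \<noteq> \<zero>\<^bsub>R\<^esub>}"
      using internal_direct_sum_decompose[OF ds x(1)] by blast
    let ?K = "{h \<in> carrier G. c h \<noteq> \<zero>\<^bsub>R\<^esub>}"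
    define d where "d = (\<lambda>h\<in>carrier G. ?p (c h))"
    have K: "finite ?K" and cA: "\<And>h. h \<in> carrier G \<Longrightarrow> c h \<in> A h"
      using c(1) by (auto simp: finsupp_families_def)
    have ccarr: "c h \<in> carrier R" if "h \<in> carrier G" for h
      using cA Acarr that by blast
    have "y = finsum ?S (?p \<circ> c) ?K"
      unfolding x(2) by (subst c(2), rule p.hom_finsum) (use ccarr in auto)
    also have "\<dots> = finsum ?S d ?K"
      by (rule p.S.finsum_cong') (use ccarr in \<open>auto simp: d_def\<close>)
    also have "\<dots> = finsum ?S d {h \<in> carrier G. d h \<noteq> \<zero>\<^bsub>?S\<^esub>}"
      by (rule finsum_support[OF agS, symmetric]) (use K ccarr in \<open>auto simp: d_def\<close>)
    finally have y: "y = finsum ?S d {h \<in> carrier G. d h \<noteq> \<zero>\<^bsub>?S\<^esub>}" .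
    have "{h \<in> carrier G. d h \<noteq> \<zero>\<^bsub>?S\<^esub>} \<subseteq> ?K"
      by (auto simp: d_def)
    then have "finite {h \<in> carrier G. d h \<noteq> \<zero>\<^bsub>?S\<^esub>}"
      using K by (rule finite_subset)
    moreover have "d \<in> (\<Pi>\<^sub>E h\<in>carrier G. ?A h)"
      unfolding d_def quotient_grading_def restrict_PiE_iff using cA by blast
    ultimately have "d \<in> finsupp_families ?S (carrier G) ?A"
      unfolding finsupp_families_def by blast
    with y show "\<exists>f\<in>finsupp_families ?S (carrier G) ?A.
        y = finsum ?S f {h \<in> carrier G. f h \<noteq> \<zero>\<^bsub>?S\<^esub>}"
      by blast
  next
    fix F f g
    assume F: "finite F" "F \<subseteq> carrier G" and f: "\<And>i. i \<in> F \<Longrightarrow> f i \<in> ?A i"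
      and sum: "finsum ?S f F = \<zero>\<^bsub>?S\<^esub>" and g: "g \<in> F"
    have "\<forall>i\<in>F. \<exists>a\<in>A i. f i = ?p a"
      using f by (auto simp: quotient_grading_def)
    then obtain a where a: "\<And>i. i \<in> F \<Longrightarrow> a i \<in> A i" "\<And>i. i \<in> F \<Longrightarrow> f i = ?p (a i)"
      by metis
    have acarr: "a \<in> F \<rightarrow> carrier R"
      using a(1) Acarr F by blast
    have "?p (finsum R a F) = finsum ?S (?p \<circ> a) F"
      by (rule p.hom_finsum[OF acarr])
    also have "\<dots> = finsum ?S f F"
      by (rule p.S.finsum_cong') (use a(2) acarr p.hom_closed in \<open>auto simp: Pi_iff\<close>)
    finally have "finsum R a F \<in> ?I"
      using ker[of "finsum R a F"] sum acarr by (simp add: R.finsum_closed)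
    then have "a g \<in> ?I"
      using homogeneous_components_in_Ann[OF assms F, of a g] a(1) g by blast
    then show "f g = \<zero>\<^bsub>?S\<^esub>"
      using a(2)[OF g] I.a_rcos_const by (simp add: zS)
  qed
  moreover have "x \<otimes>\<^bsub>?S\<^esub> y \<in> ?A (g \<otimes>\<^bsub>G\<^esub> h)"
    if gh: "g \<in> carrier G" "h \<in> carrier G" and x: "x \<in> ?A g" and y: "y \<in> ?A h" for g h x y
  proof -
    obtain a b where ab: "a \<in> A g" "x = ?p a" "b \<in> A h" "y = ?p b"
      using x y by (auto simp: quotient_grading_def)
    have "x \<otimes>\<^bsub>?S\<^esub> y = ?p (a \<otimes>\<^bsub>R\<^esub> b)"
      using p.hom_mult[of a b] ab gh Acarr by (auto simp: subset_iff)
    then show ?thesis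
      using AA gh ab unfolding quotient_grading_def by blast
  qed
  moreover have "cring ?S"
    by (rule p.S.cring_axioms)
  ultimately show ?thesis
    unfolding graded_ring_def by blast
qed

lemma graded_ideal_carrier:
  assumes "graded_ring G S A"
  shows "graded_ideal G S A (carrier S)"
proof -
  have cr: "cring S" and ds: "internal_direct_sum S (carrier G) A (carrier S)"
    using assms unfolding graded_ring_def by auto
  interpret cring S by fact
  have "internal_direct_sum S (carrier G) (\<lambda>g. carrier S \<inter> A g) (carrier S)"
    by (rule internal_direct_sum_Int_carrier[OF ds])
  then show ?thesis
    unfolding graded_ideal_def using oneideal by blast
qed

section \<open>Continuity of the natural map\<close>

lemma topspace_zariski_topology:
  assumes "graded_submodule G R M B (carrier M)"
  shows "topspace (zariski_topology G R A M B) = Upsilon G R A M B"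
proof -
  have "\<not> carrier M \<subseteq> P" if P: "P \<in> Upsilon G R A M B" for P
  proof
    assume "carrier M \<subseteq> P"
    then have "residual R M P = carrier R"
      using submodule.smult_closed[of "carrier M" R M] assms
      by (auto simp: residual_def graded_submodule_def)
    with P show False
      by (simp add: Upsilon_def graded_weakly_prime_def)
  qed
  then have "chi G R A M B (carrier M) = {}"
    by (auto simp: chi_def)
  then show ?thesis
    unfolding zariski_topology_def topology_generated_by_topspace
    using assms(1) by fastforce
qed

lemma closedin_chi:
  assumes "topspace (zariski_topology G R A M B) = Upsilon G R A M B"
    and "graded_submodule G R M B P"
  shows "closedin (zariski_topology G R A M B) (chi G R A M B P)"
proof -
  have "openin (zariski_topology G R A M B) (Upsilon G R A M B - chi G R A M B P)"
    unfolding zariski_topology_def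
    by (rule topology_generated_by_Basis) (use assms(2) in blast)
  then show ?thesis
    by (auto simp: closedin_def assms(1) chi_def)
qed

lemma Ann_subset_residual: "\<zero>\<^bsub>M\<^esub> \<in> P \<Longrightarrow> Ann R M \<subseteq> residual R M P"
  by (auto simp: Ann_def residual_def)

lemma coset_in_natural_map_iff:
  assumes "Module.module R M" "submodule P R M" "r \<in> carrier R"
  shows "Ann R M +>\<^bsub>R\<^esub> r \<in> natural_map R M P \<longleftrightarrow> r \<in> residual R M P"
proof
  interpret Module.module R M by fact
  interpret I: ideal "Ann R M" R by (rule ideal_Ann[OF assms(1)])
  interpret J: ideal "residual R M P" R by (rule ideal_residual[OF assms(1,2)])
  assume "Ann R M +>\<^bsub>R\<^esub> r \<in> natural_map R M P"
  then obtain s where s: "s \<in> residual R M P" "Ann R M +>\<^bsub>R\<^esub> r = Ann R M +>\<^bsub>R\<^esub> s"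
    by (auto simp: natural_map_def)
  then have "r \<in> Ann R M +>\<^bsub>R\<^esub> s"
    using I.a_rcos_self[OF assms(3)] by simp
  then obtain a where a: "a \<in> Ann R M" "r = a \<oplus>\<^bsub>R\<^esub> s"
    by (auto simp: a_r_coset_def r_coset_def)
  have "\<zero>\<^bsub>M\<^esub> \<in> P"
    using assms(2) subgroup.one_closed[of P "add_monoid M"] by (simp add: submodule_def)
  then have "a \<in> residual R M P"
    using a(1) Ann_subset_residual by blast
  then show "r \<in> residual R M P"
    using J.a_closed[OF _ s(1)] a(2) by simp
qed (auto simp: natural_map_def)

text \<open>
  The set \<open>C\<close> is the preimage under the natural map of the subbasic closed set given by \<open>J\<close>.  It is
  again a set of the form \<open>\<chi>(N)\<close>, namely for \<open>N = \<Inter>C\<close>.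
\<close>

lemma preimage_chi_natural_map:
  fixes J :: "'a set set"
  assumes "graded_module G R A M B"
  defines "C \<equiv> {P \<in> Upsilon G R A M B. J \<subseteq> natural_map R M P}"
  assumes "C \<noteq> {}"
  shows "graded_submodule G R M B (\<Inter>C)" "C = chi G R A M B (\<Inter>C)"
proof -
  have mod: "Module.module R M"
    using assms(1) by (simp add: graded_module_def)
  show gr: "graded_submodule G R M B (\<Inter>C)"
    by (rule graded_submodule_Inter[OF assms(1,3)]) (auto simp: C_def Upsilon_def)
  have subm: "submodule P R M" if "P \<in> Upsilon G R A M B" for P
    using that by (simp add: Upsilon_def graded_submodule_def)
  have J: "J \<subseteq> natural_map R M (\<Inter>C)"
  proof
    fix j assume j: "j \<in> J"
    obtain Q where Q: "Q \<in> C"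
      using assms(3) by blast
    then obtain r where r: "r \<in> carrier R" "j = Ann R M +>\<^bsub>R\<^esub> r"
      using j by (auto simp: C_def natural_map_def residual_def)
    have "r \<in> residual R M P" if "P \<in> C" for P
      using that j r coset_in_natural_map_iff[OF mod subm r(1), of P] by (auto simp: C_def)
    then have "r \<in> residual R M (\<Inter>C)"
      using r(1) by (auto simp: residual_def)
    then show "j \<in> natural_map R M (\<Inter>C)"
      by (auto simp: natural_map_def r(2))
  qed
  have mono: "natural_map R M N \<subseteq> natural_map R M P" if "N \<subseteq> P" for N P
    using that by (auto simp: natural_map_def residual_def)
  have "P \<in> C \<longleftrightarrow> P \<in> chi G R A M B (\<Inter>C)" for P
  proof
    assume "P \<in> C"
    then show "P \<in> chi G R A M B (\<Inter>C)"
      by (auto simp: chi_def C_def)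
  next
    assume "P \<in> chi G R A M B (\<Inter>C)"
    then show "P \<in> C"
      using J mono[of "\<Inter>C" P] unfolding C_def chi_def by blast
  qed
  then show "C = chi G R A M B (\<Inter>C)"
    by blast
qed

lemma continuous_map_natural_map:
  assumes gm: "graded_module G R A M B"
    and top: "topspace (zariski_topology G S A' N B') = Upsilon G S A' N B'"
    and img: "natural_map R M ` Upsilon G R A M B \<subseteq> Upsilon G S A' N B'"
  shows "continuous_map (zariski_topology G R A M B) (zariski_topology G S A' N B')
    (natural_map R M)"
proof -
  let ?X = "zariski_topology G R A M B"
  have topX: "topspace ?X = Upsilon G R A M B"
    by (rule topspace_zariski_topology[OF graded_submodule_carrier[OF gm]])
  let ?\<S> = "{Upsilon G S A' N B' - chi G S A' N B' P |P. graded_submodule G S N B' P}"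
  have un: "\<Union>?\<S> = Upsilon G S A' N B'"
    using top unfolding zariski_topology_def topology_generated_by_topspace .
  have "openin ?X (natural_map R M -` U \<inter> topspace ?X)" if "U \<in> ?\<S>" for U
  proof -
    obtain J where J: "U = Upsilon G S A' N B' - chi G S A' N B' J"
      using \<open>U \<in> ?\<S>\<close> by blast
    define C where "C = {P \<in> Upsilon G R A M B. J \<subseteq> natural_map R M P}"
    have "closedin ?X C"
    proof (cases "C = {}")
      case False
      note pre = preimage_chi_natural_map[OF gm, where J = J, folded C_def, OF False]
      show ?thesis
        using closedin_chi[OF topX pre(1)] pre(2) by simp
    qed simp
    moreover have "natural_map R M -` U \<inter> topspace ?X = topspace ?X - C"
      using img by (auto simp: topX J C_def chi_def)
    ultimately show ?thesis
      by (simp add: openin_diff)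
  qed
  then show ?thesis
    unfolding zariski_topology_def[of G S A' N B']
    by (rule continuous_on_generated_topo) (use img un topX in auto)
qed

section \<open>Connectedness\<close>

text \<open>\<open>R/R\<close> is the zero ring, and the zero ring has no proper ideal.\<close>

lemma GWSpec_quotient_carrier:
  assumes "cring R"
  shows "GWSpec G (R Quot carrier R) A' = {}"
proof -
  interpret cring R by fact
  interpret I: ideal "carrier R" R by (rule oneideal)
  have one: "carrier (R Quot carrier R) \<subseteq> {\<zero>\<^bsub>R Quot carrier R\<^esub>}"
  proof
    fix y assume "y \<in> carrier (R Quot carrier R)"
    then obtain r where "r \<in> carrier R" "y = carrier R +>\<^bsub>R\<^esub> r"
      by (auto simp: FactRing_def A_RCOSETS_def RCOSETS_def a_r_coset_def)
    then show "y \<in> {\<zero>\<^bsub>R Quot carrier R\<^esub>}"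
      using I.a_rcos_const by (simp add: FactRing_def)
  qed
  have "K = carrier (R Quot carrier R)" if "ideal K (R Quot carrier R)" for K
    using additive_subgroup.zero_closed[OF ideal.axioms(1)[OF that]]
      additive_subgroup.a_subset[OF ideal.axioms(1)[OF that]] one
    by blast
  then show ?thesis
    by (auto simp: GWSpec_def graded_weakly_prime_def graded_ideal_def)
qed

theorem theorem3p1:
  fixes G :: "('g, 'k) monoid_scheme"
    and R :: "('a, 'm) ring_scheme" and A :: "'g \<Rightarrow> 'a set"
    and M :: "('a, 'b, 'n) module_scheme" and B :: "'g \<Rightarrow> 'b set"
  assumes "comm_group G"
    and "graded_ring G R A"
    and "graded_module G R A M B"
    and "graded_weakly_topological G R A M B"
    and "graded_pseudo_weakly_primeful G R A M B"
    and "connected_space (zariski_topology G R A M B)"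
  shows "connected_space
           (zariski_topology G
              (R Quot Ann R M) (quotient_grading R A (Ann R M))
              (ring_as_module (R Quot Ann R M)) (quotient_grading R A (Ann R M)))"
proof -
  let ?S = "R Quot Ann R M" and ?A = "quotient_grading R A (Ann R M)"
  let ?X = "zariski_topology G R A M B"
  let ?Y = "zariski_topology G ?S ?A (ring_as_module ?S) ?A"
  have mod: "Module.module R M"
    using assms(3) by (simp add: graded_module_def)
  interpret Module.module R M by (rule mod)
  have grp: "group G"
    using assms(1) by (simp add: comm_group_def)
  have grS: "graded_ring G ?S ?A"
    by (rule graded_ring_quotient_Ann[OF grp assms(2,3)])
  then have crS: "cring ?S"
    by (simp add: graded_ring_def)
  have Ups: "Upsilon G ?S ?A (ring_as_module ?S) ?A = GWSpec G ?S ?A"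
    by (rule Upsilon_ring_as_module[OF crS])
  have grY: "graded_submodule G ?S (ring_as_module ?S) ?A (carrier (ring_as_module ?S))"
    using graded_ideal_carrier[OF grS] by (simp add: graded_submodule_ring_as_module[OF crS])
  have topY: "topspace ?Y = Upsilon G ?S ?A (ring_as_module ?S) ?A"
    by (rule topspace_zariski_topology[OF grY])
  have topX: "topspace ?X = Upsilon G R A M B"
    by (rule topspace_zariski_topology[OF graded_submodule_carrier[OF assms(3)]])
  show ?thesis
  proof (cases "carrier M = {\<zero>\<^bsub>M\<^esub>}")
    case True
    then have "Ann R M = carrier R"
      by (auto simp: Ann_def residual_def)
    then have "topspace ?Y = {}"
      using topY Ups GWSpec_quotient_carrier[OF R.is_cring, of G ?A] by simp
    then show ?thesis
      by (simp add: connected_space_def)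
  next
    case False
    then have surj: "natural_map R M ` Upsilon G R A M B = GWSpec G ?S ?A"
      using assms(5) by (auto simp: graded_pseudo_weakly_primeful_def)
    have "continuous_map ?X ?Y (natural_map R M)"
      by (rule continuous_map_natural_map[OF assms(3) topY]) (simp add: surj Ups)
    moreover have "natural_map R M ` topspace ?X = topspace ?Y"
      by (simp add: topX topY Ups surj)
    ultimately show ?thesis
      using assms(6) by (metis connectedin_continuous_map_image connectedin_topspace)
  qed
qed

end
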